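(* Let $d\ge 1$ be an integer. Then $$\gamma_d^{\mathrm L}(Q_{d+1})=\gamma_t(Q_{d+1})=2\,\gamma(Q_d).$$
   Context: All graphs are finite and simple; $N_G(u)$ is the open neighborhood of $u$ in $G$. A set $D\subseteq V(G)$ is a dominating set if every vertex of $V(G)\setminus D$ has a neighbor in $D$; $\gamma(G)$ is the minimum cardinality of a dominating set of $G$. A total dominating set is a set $D\subseteq V(G)$ such that every vertex of $G$ (including those in $D$) has a neighbor in $D$; the total domination number $\gamma_t(G)$ is the minimum cardinality of a total dominating set of $G$. For an integer $k\ge 0$, a dominating set $D$ of $G$ is a $k$-limited dominating set if $|N_G(u)\setminus D|\le k$ for every $u\in D$, and $\gamma_k^{\mathrm L}(G)$ is the minimum cardinality of a $k$-limited dominating set of $G$. The hypercube $Q_d$ has vertex set $\{0,1\}^d$, two vertices being adjacent if and only if they differ in exactly one coordinate. *)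

theory Defs
  imports "Graph_Theory.Pair_Digraph"
begin

text \<open>
  A finite simple graph is a \<^locale>\<open>pair_graph\<close>: a finite vertex set together with a
  symmetric, irreflexive set of ordered pairs, so an edge \<open>{u, v}\<close> is the two arcs
  \<open>(u, v)\<close> and \<open>(v, u)\<close>.
\<close>

definition open_neighborhood :: "'a pair_pre_digraph \<Rightarrow> 'a \<Rightarrow> 'a set" where
  "open_neighborhood G u = {v \<in> pverts G. (u, v) \<in> parcs G}"

definition dominating_set :: "'a pair_pre_digraph \<Rightarrow> 'a set \<Rightarrow> bool" where
  "dominating_set G D \<longleftrightarrow>
     D \<subseteq> pverts G \<and> (\<forall>v \<in> pverts G - D. \<exists>u \<in> D. u \<in> open_neighborhood G v)"

definition total_dominating_set :: "'a pair_pre_digraph \<Rightarrow> 'a set \<Rightarrow> bool" where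
  "total_dominating_set G D \<longleftrightarrow>
     D \<subseteq> pverts G \<and> (\<forall>v \<in> pverts G. \<exists>u \<in> D. u \<in> open_neighborhood G v)"

definition limited_dominating_set :: "nat \<Rightarrow> 'a pair_pre_digraph \<Rightarrow> 'a set \<Rightarrow> bool" where
  "limited_dominating_set k G D \<longleftrightarrow>
     dominating_set G D \<and> (\<forall>u \<in> D. card (open_neighborhood G u - D) \<le> k)"

definition domination_number :: "'a pair_pre_digraph \<Rightarrow> nat" where
  "domination_number G = (LEAST n. \<exists>D. dominating_set G D \<and> card D = n)"

text \<open>
  The value is meaningful only for graphs without isolated vertices; otherwise there is no
  total dominating set.
\<close>

definition total_domination_number :: "'a pair_pre_digraph \<Rightarrow> nat" where
  "total_domination_number G = (LEAST n. \<exists>D. total_dominating_set G D \<and> card D = n)"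

definition limited_domination_number :: "nat \<Rightarrow> 'a pair_pre_digraph \<Rightarrow> nat" where
  "limited_domination_number k G = (LEAST n. \<exists>D. limited_dominating_set k G D \<and> card D = n)"

text \<open>
  The elements of \<open>{0,1}\<^sup>d\<close> are the Boolean lists of length \<open>d\<close>.
\<close>

definition hypercube :: "nat \<Rightarrow> bool list pair_pre_digraph" where
  "hypercube d =
     \<lparr> pverts = {x. length x = d},
       parcs = {(x, y). length x = d \<and> length y = d \<and> card {i. i < d \<and> x ! i \<noteq> y ! i} = 1} \<rparr>"

lemma pair_graph_hypercube: "pair_graph (hypercube d)"
proof -
  have fin: "finite {x :: bool list. length x = d}"
    using finite_lists_length_eq[of "UNIV :: bool set" d] by simp
  have "parcs (hypercube d) \<subseteq> {x. length x = d} \<times> {x. length x = d}"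
    by (auto simp: hypercube_def)
  then have fin': "finite (parcs (hypercube d))"
    using fin finite_subset by blast
  have comm: "{i. i < d \<and> x ! i \<noteq> y ! i} = {i. i < d \<and> y ! i \<noteq> x ! i}" for x y :: "bool list"
    by blast
  have "sym (parcs (hypercube d))"
  proof (rule symI)
    fix x y :: "bool list"
    assume "(x, y) \<in> parcs (hypercube d)"
    then show "(y, x) \<in> parcs (hypercube d)"
      unfolding hypercube_def pair_pre_digraph.simps mem_Collect_eq case_prod_conv comm[of y x]
      by blast
  qed
  then have "symmetric (hypercube d)"
    by (simp only: symmetric_def with_proj_simps)
  moreover have "finite (pverts (hypercube d))"
    using fin by (simp add: hypercube_def)
  moreover have "fst e \<in> pverts (hypercube d)" "snd e \<in> pverts (hypercube d)" "fst e \<noteq> snd e"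
    if "e \<in> parcs (hypercube d)" for e
  proof -
    obtain x y where e: "e = (x, y)" by (cases e)
    with that have xy: "length x = d" "length y = d" "card {i. i < d \<and> x ! i \<noteq> y ! i} = 1"
      by (simp_all only: hypercube_def pair_pre_digraph.simps mem_Collect_eq case_prod_conv)
    show "fst e \<in> pverts (hypercube d)" "snd e \<in> pverts (hypercube d)"
      using xy(1,2) by (simp_all add: e hypercube_def)
    have "x \<noteq> y"
    proof
      assume "x = y"
      with xy(3) show False by simp
    qed
    then show "fst e \<noteq> snd e" by (simp add: e)
  qed
  ultimately show ?thesis
    using fin' by unfold_locales
qed

text \<open>The minima in the three domination numbers range over nonempty sets.\<close>

lemma dominating_set_pverts: "dominating_set G (pverts G)"
  by (simp add: dominating_set_def)

lemma limited_dominating_set_pverts: "limited_dominating_set k G (pverts G)"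
proof -
  have empty: "open_neighborhood G u - pverts G = {}" for u
    unfolding open_neighborhood_def by blast
  show ?thesis
    unfolding limited_dominating_set_def empty by (simp add: dominating_set_pverts)
qed

lemma total_dominating_set_hypercube:
  assumes "d \<ge> 1"
  shows "total_dominating_set (hypercube d) (pverts (hypercube d))"
proof -
  have "\<exists>y. length y = d \<and> card {i. i < d \<and> x ! i \<noteq> y ! i} = 1"
    if "length x = d" for x :: "bool list"
  proof (intro exI conjI)
    show "length (x[0 := \<not> x ! 0]) = d" using that by simp
    have "{i. i < d \<and> x ! i \<noteq> x[0 := \<not> x ! 0] ! i} = {0}"
      using that assms by (auto simp: nth_list_update split: if_splits)
    then show "card {i. i < d \<and> x ! i \<noteq> x[0 := \<not> x ! 0] ! i} = 1" by simp
  qed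
  then show ?thesis
    by (auto simp: total_dominating_set_def open_neighborhood_def hypercube_def)
qed

end

theory Submission
  imports Defs
begin

text \<open>
  Every vertex of \<open>Q\<^bsub>d+1\<^esub>\<close> has degree \<open>d + 1\<close>, so a dominating set is \<open>d\<close>-limited iff each of
  its members has a neighbor in it, that is, iff it is total. If \<open>D\<close> dominates \<open>Q\<^sub>d\<close> then
  \<open>{0,1} \<times> D\<close> totally dominates \<open>Q\<^bsub>d+1\<^esub>\<close>. Conversely, split a total dominating set \<open>T\<close> into its
  vertices of even and of odd weight. Deleting the first coordinate is a bijection from each parity
  class onto \<open>Q\<^sub>d\<close>; as the neighbors of the vertices of one class lie in the other, each half
  of \<open>T\<close> projects to a dominating set of \<open>Q\<^sub>d\<close>.
\<close>

lemma pverts_hypercube [simp]: "pverts (hypercube d) = {x. length x = d}"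
  by (simp add: hypercube_def)

lemma finite_pverts_hypercube: "finite {x :: bool list. length x = d}"
  using finite_lists_length_eq[of "UNIV :: bool set" d] by simp

lemma dominating_set_hypercube_finite: "dominating_set (hypercube d) D \<Longrightarrow> finite D"
  by (metis dominating_set_def pverts_hypercube finite_pverts_hypercube finite_subset)

lemma total_dominating_set_hypercube_finite: "total_dominating_set (hypercube d) D \<Longrightarrow> finite D"
  by (metis total_dominating_set_def pverts_hypercube finite_pverts_hypercube finite_subset)

text \<open>This is the product structure of the cube: two copies of \<open>hypercube d\<close>
  joined by a perfect matching. It replaces the count of differing positions by a recursion on
  lists, which carries all later inductions.\<close>

lemma parcs_hypercube_Cons:
  "(a # x, b # y) \<in> parcs (hypercube (Suc d)) \<longleftrightarrow>
     (a \<noteq> b \<and> x = y \<and> length x = d) \<or> (a = b \<and> (x, y) \<in> parcs (hypercube d))"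
proof (cases "length x = d \<and> length y = d")
  case True
  let ?S = "{i. i < d \<and> x ! i \<noteq> y ! i}"
  have diff: "{i. i < Suc d \<and> (a # x) ! i \<noteq> (b # y) ! i} = (if a \<noteq> b then {0} else {}) \<union> Suc ` ?S"
    (is "?L = ?R")
  proof (intro set_eqI)
    show "i \<in> ?L \<longleftrightarrow> i \<in> ?R" for i by (cases i) auto
  qed
  have "card ?R = (if a \<noteq> b then 1 else 0) + card ?S"
    by (subst card_Un_disjoint) (auto simp: card_image)
  then have "card {i. i < Suc d \<and> (a # x) ! i \<noteq> (b # y) ! i} =
      (if a \<noteq> b then 1 else 0) + card ?S"
    unfolding diff .
  \<comment> \<open>A total count of 1 leaves two cases: the heads differ and \<open>?S\<close> is
    empty, or the heads agree and \<open>?S\<close> is a singleton.\<close>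
  moreover have "card ?S = 0 \<longleftrightarrow> x = y"
    using True by (auto simp: list_eq_iff_nth_eq)
  ultimately show ?thesis
    using True unfolding hypercube_def pair_pre_digraph.simps mem_Collect_eq case_prod_conv
    by (cases "a = b") simp_all
next
  case False
  then show ?thesis by (auto simp: hypercube_def)
qed

lemma parcs_hypercube_length:
  "(x, y) \<in> parcs (hypercube d) \<Longrightarrow> length x = d \<and> length y = d"
  by (simp add: hypercube_def)

lemma open_neighborhood_hypercube:
  "open_neighborhood (hypercube d) x = {y. (x, y) \<in> parcs (hypercube d)}"
  by (auto simp: open_neighborhood_def dest: parcs_hypercube_length)

lemma open_neighborhood_hypercube_Cons:
  assumes "length x = d"
  shows "open_neighborhood (hypercube (Suc d)) (a # x) =
    insert ((\<not> a) # x) (Cons a ` open_neighborhood (hypercube d) x)" (is "?L = ?R")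
proof (intro set_eqI)
  fix z
  show "z \<in> ?L \<longleftrightarrow> z \<in> ?R"
    using assms
    by (cases z) (auto simp: open_neighborhood_hypercube parcs_hypercube_Cons
        dest: parcs_hypercube_length)
qed

lemma finite_open_neighborhood_hypercube: "finite (open_neighborhood (hypercube d) x)"
  by (rule finite_subset[OF _ finite_pverts_hypercube[of d]]) (auto simp: open_neighborhood_def)

lemma card_open_neighborhood_hypercube:
  "length x = d \<Longrightarrow> card (open_neighborhood (hypercube d) x) = d"
proof (induction x arbitrary: d)
  case Nil
  then show ?case by (simp add: open_neighborhood_def hypercube_def)
next
  case (Cons a x)
  then obtain e where e: "d = Suc e" "length x = e" by auto
  have "(\<not> a) # x \<notin> Cons a ` open_neighborhood (hypercube e) x" by auto
  then show ?case
    using e Cons.IH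
    by (simp add: open_neighborhood_hypercube_Cons finite_open_neighborhood_hypercube card_image)
qed

lemma limited_iff_total_dominating_set_hypercube:
  "limited_dominating_set d (hypercube (Suc d)) D \<longleftrightarrow> total_dominating_set (hypercube (Suc d)) D"
proof -
  let ?N = "open_neighborhood (hypercube (Suc d))"
  have *: "card (?N u - D) \<le> d \<longleftrightarrow> (\<exists>v\<in>D. v \<in> ?N u)" if "length u = Suc d" for u
  proof
    assume "card (?N u - D) \<le> d"
    then have "?N u - D \<noteq> ?N u"
      using card_open_neighborhood_hypercube[OF that] by auto
    then show "\<exists>v\<in>D. v \<in> ?N u" by blast
  next
    assume "\<exists>v\<in>D. v \<in> ?N u"
    then have "?N u - D \<subset> ?N u" by blast
    then have "card (?N u - D) < card (?N u)"
      by (intro psubset_card_mono finite_open_neighborhood_hypercube)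
    then show "card (?N u - D) \<le> d"
      using card_open_neighborhood_hypercube[OF that] by simp
  qed
  \<comment> \<open>Domination gives neighbors in \<open>D\<close> to the vertices outside
    \<open>D\<close>; by \<open>*\<close>, the limit gives them to the members of
    \<open>D\<close>.\<close>
  show ?thesis
    unfolding limited_dominating_set_def dominating_set_def total_dominating_set_def
      pverts_hypercube
    using * by blast
qed

fun odd_weight :: "bool list \<Rightarrow> bool" where
  "odd_weight [] = False"
| "odd_weight (a # x) = (a \<noteq> odd_weight x)"

text \<open>An edge changes exactly one coordinate, so it flips the parity: the cube is
  bipartite.\<close>

lemma odd_weight_parcs_hypercube:
  "(x, y) \<in> parcs (hypercube d) \<Longrightarrow> odd_weight x \<noteq> odd_weight y"
proof (induction x arbitrary: y d)
  case Nil
  then show ?case by (auto simp: hypercube_def)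
next
  case (Cons a x)
  then obtain e where e: "d = Suc e" using parcs_hypercube_length by fastforce
  then obtain b z where "y = b # z"
    using Cons.prems parcs_hypercube_length by (metis length_Suc_conv)
  then show ?case
    using Cons e by (auto simp: parcs_hypercube_Cons)
qed

lemma total_dominating_set_hypercube_Suc:
  assumes "dominating_set (hypercube d) D"
  shows "total_dominating_set (hypercube (Suc d)) (Cons False ` D \<union> Cons True ` D)"
  unfolding total_dominating_set_def
proof (intro conjI ballI)
  show "Cons False ` D \<union> Cons True ` D \<subseteq> pverts (hypercube (Suc d))"
    using assms by (auto simp: dominating_set_def)
next
  fix v assume "v \<in> pverts (hypercube (Suc d))"
  then obtain a x where v: "v = a # x" "length x = d" by (auto simp: length_Suc_conv)
  show "\<exists>u\<in>Cons False ` D \<union> Cons True ` D. u \<in> open_neighborhood (hypercube (Suc d)) v"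
  \<comment> \<open>If \<open>x\<close> is in \<open>D\<close>, the matching edge leads to its twin
    in the other copy; otherwise a dominator of \<open>x\<close> is taken in the same copy.\<close>
  proof (cases "x \<in> D")
    case True
    then have "(\<not> a) # x \<in> Cons False ` D \<union> Cons True ` D" by (cases a) auto
    then show ?thesis using v by (auto simp: open_neighborhood_hypercube_Cons)
  next
    case False
    then obtain u where "u \<in> D" "u \<in> open_neighborhood (hypercube d) x"
      using assms v by (auto simp: dominating_set_def)
    moreover from this have "a # u \<in> Cons False ` D \<union> Cons True ` D" by (cases a) auto
    ultimately show ?thesis using v by (auto simp: open_neighborhood_hypercube_Cons)
  qed
qed

lemma dominating_set_parity_class:
  assumes "total_dominating_set (hypercube (Suc d)) T"
  shows "dominating_set (hypercube d) (tl ` {u \<in> T. odd_weight u = p})" (is "dominating_set _ ?D")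
  unfolding dominating_set_def
proof (intro conjI ballI)
  show "?D \<subseteq> pverts (hypercube d)"
    using assms by (auto simp: total_dominating_set_def)
next
  fix x assume "x \<in> pverts (hypercube d) - ?D"
  then have x: "length x = d" "x \<notin> ?D" by auto
  \<comment> \<open>This head gives \<open>?a # x\<close> the parity opposite to \<open>p\<close>,
    so that all its neighbors have parity \<open>p\<close>.\<close>
  let ?a = "p = odd_weight x"
  have "?a # x \<in> pverts (hypercube (Suc d))" using x by simp
  then obtain u where u: "u \<in> T" "u \<in> open_neighborhood (hypercube (Suc d)) (?a # x)"
    using assms unfolding total_dominating_set_def by blast
  have "odd_weight u = p"
    using u(2) odd_weight_parcs_hypercube[of "?a # x" u "Suc d"]
    by (auto simp: open_neighborhood_hypercube)
  then have "tl u \<in> ?D" using u(1) by blast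
  \<comment> \<open>The first case is the matching edge; it is ruled out because \<open>x\<close>
    lies outside the projection.\<close>
  moreover have "tl u = x \<or> tl u \<in> open_neighborhood (hypercube d) x"
    using u(2) x(1) by (auto simp: open_neighborhood_hypercube_Cons)
  ultimately show "\<exists>u\<in>?D. u \<in> open_neighborhood (hypercube d) x"
    using x(2) by blast
qed

lemma domination_number_le: "dominating_set G D \<Longrightarrow> domination_number G \<le> card D"
  unfolding domination_number_def by (rule Least_le) blast

lemma domination_number_attained: "\<exists>D. dominating_set G D \<and> card D = domination_number G"
  unfolding domination_number_def
  by (rule LeastI_ex) (use dominating_set_pverts in blast)

lemma total_domination_number_le:
  "total_dominating_set G D \<Longrightarrow> total_domination_number G \<le> card D"
  unfolding total_domination_number_def by (rule Least_le) blast

text \<open>The premise supplies the witness that \<open>LEAST\<close> requires: a graph with an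
  isolated vertex has no total dominating set.\<close>

lemma total_domination_number_attained:
  "total_dominating_set G D \<Longrightarrow> \<exists>T. total_dominating_set G T \<and> card T = total_domination_number G"
  unfolding total_domination_number_def by (rule LeastI_ex) blast

lemma total_domination_number_hypercube_Suc:
  "total_domination_number (hypercube (Suc d)) = 2 * domination_number (hypercube d)"
proof (rule antisym)
  obtain D where D: "dominating_set (hypercube d) D" "card D = domination_number (hypercube d)"
    using domination_number_attained by blast
  have "card (Cons False ` D \<union> Cons True ` D) = 2 * card D"
    using dominating_set_hypercube_finite[OF D(1)]
    by (subst card_Un_disjoint) (auto simp: card_image)
  then show "total_domination_number (hypercube (Suc d)) \<le> 2 * domination_number (hypercube d)"
    using total_domination_number_le[OF total_dominating_set_hypercube_Suc[OF D(1)]] D(2) by simp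
next
  obtain T where T: "total_dominating_set (hypercube (Suc d)) T"
    "card T = total_domination_number (hypercube (Suc d))"
    using total_domination_number_attained total_dominating_set_hypercube[of "Suc d"] by force
  have fin: "finite T" by (rule total_dominating_set_hypercube_finite[OF T(1)])
  \<comment> \<open>An image is no larger than its source, so the lower bound for the projection
    passes to the parity class.\<close>
  have le: "domination_number (hypercube d) \<le> card {u \<in> T. odd_weight u = p}" for p
    using domination_number_le[OF dominating_set_parity_class[OF T(1)], of p]
      card_image_le[of "{u \<in> T. odd_weight u = p}" tl] fin by simp
  have "T = {u \<in> T. odd_weight u = True} \<union> {u \<in> T. odd_weight u = False}" by auto
  then have "card T = card {u \<in> T. odd_weight u = True} + card {u \<in> T. odd_weight u = False}"
    using fin by (subst card_Un_disjoint[symmetric]) auto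
  then show "2 * domination_number (hypercube d) \<le> total_domination_number (hypercube (Suc d))"
    using le[of True] le[of False] T(2) by simp
qed

theorem corollary19:
  fixes d :: nat
  assumes "d \<ge> 1"
  shows "limited_domination_number d (hypercube (d + 1)) = total_domination_number (hypercube (d + 1))
    \<and> total_domination_number (hypercube (d + 1)) = 2 * domination_number (hypercube d)"
  \<comment> \<open>Once unfolded, both numbers on \<open>hypercube (d + 1)\<close> are minima over
    the same family of sets.\<close>
  by (simp add: limited_domination_number_def total_domination_number_def
      limited_iff_total_dominating_set_hypercube
      total_domination_number_hypercube_Suc[unfolded total_domination_number_def])

end
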